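(* Let $L$ be a residuated lattice, $n\geq 1$ an integer, and let $F_1$ and $F_2$ be filters of $L$ with $F_1\subseteq F_2$. If $F_1$ is an $n$-fold fantastic filter of $L$, then so is $F_2$.
   Context: A residuated lattice is an algebra $(L,\wedge,\vee,\otimes,\rightarrow,0,1)$ such that $(L,\wedge,\vee,0,1)$ is a bounded lattice, $(L,\otimes,1)$ is a commutative monoid, and $x\otimes y\leq z$ iff $x\leq y\rightarrow z$. A filter of $L$ is a nonempty subset closed under $\otimes$ and upward closed. For $x\in L$, $x^n=x\otimes\cdots\otimes x$ ($n$ factors). A subset $F\subseteq L$ is an $n$-fold fantastic filter if $1\in F$ and for all $x,y\in L$: $y\rightarrow x\in F$ implies $((x^n\rightarrow y)\rightarrow y)\rightarrow x\in F$. *)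

theory Defs
  imports Main
begin

(* The least and greatest elements are bot and top; the axiom top_eq_one identifies the
   monoid unit with the greatest element. *)
class residuated_lattice = bounded_lattice + comm_monoid_mult +
  fixes residuum :: "'a \<Rightarrow> 'a \<Rightarrow> 'a"  (infixr "\<leadsto>" 60)
  assumes top_eq_one: "top = 1"
    and residuation: "x * y \<le> z \<longleftrightarrow> x \<le> y \<leadsto> z"

definition rl_filter :: "'a::residuated_lattice set \<Rightarrow> bool" where
  "rl_filter F \<longleftrightarrow> F \<noteq> {} \<and> (\<forall>x\<in>F. \<forall>y\<in>F. x * y \<in> F) \<and>
     (\<forall>x y. x \<in> F \<longrightarrow> x \<le> y \<longrightarrow> y \<in> F)"

definition n_fold_fantastic_filter :: "nat \<Rightarrow> 'a::residuated_lattice set \<Rightarrow> bool" where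
  "n_fold_fantastic_filter n F \<longleftrightarrow> 1 \<in> F \<and>
     (\<forall>x y. (y \<leadsto> x) \<in> F \<longrightarrow> (((x ^ n \<leadsto> y) \<leadsto> y) \<leadsto> x) \<in> F)"

end

theory Submission
  imports Defs
begin

text \<open>
  Given t = y \<leadsto> x in F2, replace x by t \<leadsto> x. This element lies above both x and y, so
  y \<leadsto> (t \<leadsto> x) = 1 is in F1 and the fantastic property of F1 applies. Antitonicity then
  puts ((x ^ n \<leadsto> y) \<leadsto> y) \<leadsto> (t \<leadsto> x) in F2, and multiplying by t removes the extra premise.
\<close>

context residuated_lattice
begin

lemma le_one: "x \<le> 1"
  using top_greatest[of x] by (simp add: top_eq_one)

lemma residuum_mult_le: "(x \<leadsto> y) * x \<le> y"
  by (simp add: residuation)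

text \<open>By residuation, \<open>y * z \<le> y * z\<close> gives
  \<open>y \<le> z \<leadsto> y * z\<close>, and \<open>x\<close> lies below
  \<open>y\<close>.\<close>

lemma mult_right_mono_rl: "x \<le> y \<Longrightarrow> x * z \<le> y * z"
  using order_trans[of x y "z \<leadsto> y * z"] residuation[of y z "y * z"] residuation[of x z "y * z"]
  by simp

lemma mult_mono_rl: "x \<le> y \<Longrightarrow> u \<le> v \<Longrightarrow> x * u \<le> y * v"
  using mult_right_mono_rl[of x y u] mult_right_mono_rl[of u v y]
  by (simp add: mult.commute[of _ y])

lemma power_mono_rl: "x \<le> y \<Longrightarrow> x ^ n \<le> y ^ n"
  by (induction n) (simp_all add: mult_mono_rl)

text \<open>Residuation reduces this to
  \<open>(y \<leadsto> z) * x \<le> (y \<leadsto> z) * y \<le> z\<close>.\<close>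

lemma residuum_antimono: "x \<le> y \<Longrightarrow> y \<leadsto> z \<le> x \<leadsto> z"
  using order_trans[OF mult_mono_rl[OF order_refl] residuum_mult_le, of x y z]
  by (simp add: residuation)

lemma le_residuum: "x \<le> y \<leadsto> x"
  using mult_mono_rl[OF order_refl le_one, of x y] by (simp add: residuation)

lemma le_residuum_residuum: "x \<le> (x \<leadsto> y) \<leadsto> y"
  using residuum_mult_le[of x y] by (simp add: residuation[symmetric] mult.commute)

lemma residuum_eq_one: "x \<le> y \<Longrightarrow> x \<leadsto> y = 1"
  using residuation[of 1 x y] by (intro order.antisym le_one) simp

text \<open>A premise \<open>y\<close> nested under \<open>x\<close> can be discharged by
  multiplying with \<open>y\<close> from outside, since commutativity lets the factors
  \<open>x\<close> and \<open>y\<close> be supplied in either order.\<close>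

lemma residuum_exchange_mult_le: "(x \<leadsto> (y \<leadsto> z)) * y \<le> x \<leadsto> z"
proof -
  have "((x \<leadsto> (y \<leadsto> z)) * x) * y \<le> z"
    using residuum_mult_le by (simp add: residuation)
  then show ?thesis
    by (simp add: residuation[symmetric] mult.assoc mult.commute[of x y])
qed

end

theorem theorem7p15:
  fixes F1 F2 :: "'a::residuated_lattice set" and n :: nat
  assumes "n \<ge> 1"
    and "rl_filter F1"
    and "rl_filter F2"
    and "F1 \<subseteq> F2"
    and "n_fold_fantastic_filter n F1"
  shows "n_fold_fantastic_filter n F2"
  unfolding n_fold_fantastic_filter_def
proof (intro conjI allI impI)
  have one: "1 \<in> F1"
    and fantastic: "\<And>x y. (y \<leadsto> x) \<in> F1 \<Longrightarrow> (((x ^ n \<leadsto> y) \<leadsto> y) \<leadsto> x) \<in> F1"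
    using assms(5) by (auto simp: n_fold_fantastic_filter_def)
  have mult: "\<And>x y. x \<in> F2 \<Longrightarrow> y \<in> F2 \<Longrightarrow> x * y \<in> F2"
    and up: "\<And>x y. x \<in> F2 \<Longrightarrow> x \<le> y \<Longrightarrow> y \<in> F2"
    using assms(3) by (auto simp: rl_filter_def)
  show "1 \<in> F2"
    using one assms(4) by blast
  fix x y :: 'a
  assume t: "(y \<leadsto> x) \<in> F2"
  define z where "z = (y \<leadsto> x) \<leadsto> x"
  \<comment> \<open>The element \<open>y \<leadsto> x\<close> is only known to lie in
    \<open>F2\<close>; for \<open>z\<close> the premise becomes \<open>1\<close>, which lies in
    \<open>F1\<close>.\<close>
  have "y \<leadsto> z = 1"
    unfolding z_def by (intro residuum_eq_one le_residuum_residuum)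
  then have "((z ^ n \<leadsto> y) \<leadsto> y) \<leadsto> z \<in> F2"
    using fantastic[of y z] one assms(4) by auto
  \<comment> \<open>Here \<open>x \<le> z\<close> gives \<open>x ^ n \<le> z ^ n\<close>. The power
    sits to the left of three nested residua, so the order reverses three times; the final
    \<open>z\<close> stays fixed.\<close>
  moreover have "((z ^ n \<leadsto> y) \<leadsto> y) \<leadsto> z \<le> ((x ^ n \<leadsto> y) \<leadsto> y) \<leadsto> z"
    using le_residuum[of x "y \<leadsto> x"]
    unfolding z_def by (intro residuum_antimono power_mono_rl)
  ultimately have "((x ^ n \<leadsto> y) \<leadsto> y) \<leadsto> z \<in> F2"
    by (rule up)
  then have "(((x ^ n \<leadsto> y) \<leadsto> y) \<leadsto> z) * (y \<leadsto> x) \<in> F2"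
    using t by (rule mult)
  then show "((x ^ n \<leadsto> y) \<leadsto> y) \<leadsto> x \<in> F2"
    unfolding z_def by (rule up) (rule residuum_exchange_mult_le)
qed

end
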